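(* For every integer $n\ge 2$, $$\sum_{k=0}^n T_kT_{n-k}=\sum_{l=0}^{n-2}(l+1)T_{l+1}\,D_{n,l},$$ where $$D_{n,l}=\sum_{\substack{j,k\ge 0\\ 3j+2k\le n-2-l\\ j+4k\le n-2-l}}(-1)^{\frac{n-2-l-j-2k}{2}}\,\frac{1+(-1)^{n-2-l-j-2k}}{2}\binom{\frac{n-2-l-j-2k}{2}}{\frac{n-2-l-3j-4k}{2},\,j,\,k}2^j3^k .$$
   Context: The Tetranacci numbers $T_n$ are defined by $T_0=0$, $T_1=T_2=1$, $T_3=2$ and $T_n=T_{n-1}+T_{n-2}+T_{n-3}+T_{n-4}$ for $n\ge 4$. Here $\binom{r}{i,j,k}=\frac{r!}{i!\,j!\,k!}$ with $i+j+k=r$ is the multinomial coefficient. Conventions: a summand with $n-2-l-j-2k$ odd is $0$ (because of the factor $\frac{1+(-1)^{n-2-l-j-2k}}{2}$), and a multinomial coefficient with a negative lower entry is $0$. The indices $j,k$ run over nonnegative integers. *)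

theory Defs
  imports Complex_Main
begin

fun tetranacci :: "nat \<Rightarrow> nat" where
  "tetranacci 0 = 0"
| "tetranacci (Suc 0) = 1"
| "tetranacci (Suc (Suc 0)) = 1"
| "tetranacci (Suc (Suc (Suc 0))) = 2"
| "tetranacci (Suc (Suc (Suc (Suc n)))) =
     tetranacci (Suc (Suc (Suc n))) + tetranacci (Suc (Suc n)) + tetranacci (Suc n) + tetranacci n"

(* Meaningful for r = i + j + k.  The lower entries are integers because the convention
   that a negative entry makes the coefficient 0 is really used below. *)
definition trinomial :: "int \<Rightarrow> int \<Rightarrow> int \<Rightarrow> int \<Rightarrow> rat" where
  "trinomial r i j k =
     (if i < 0 \<or> j < 0 \<or> k < 0 then 0
      else fact (nat r) / (fact (nat i) * fact (nat j) * fact (nat k)))"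

(* Both occurrences of div 2 are exact whenever the parity factor is nonzero, since
   m - j - 2 * k and m - 3 * j - 4 * k have the same parity.  The first condition on (j, k)
   implies m - j - 2 * k \<ge> 0. *)
definition D :: "nat \<Rightarrow> nat \<Rightarrow> rat" where
  "D n l =
     (let m = int n - 2 - int l in
      \<Sum>(j, k) \<in> {(j :: nat, k :: nat). 3 * int j + 2 * int k \<le> m \<and> int j + 4 * int k \<le> m}.
        (-1) powi ((m - int j - 2 * int k) div 2)
        * ((1 + (-1) powi (m - int j - 2 * int k)) / 2)
        * trinomial ((m - int j - 2 * int k) div 2)
            ((m - 3 * int j - 4 * int k) div 2) (int j) (int k)
        * 2 ^ j * 3 ^ k)"

end

theory Submission
  imports Defs "HOL-Computational_Algebra.Formal_Power_Series"
begin

text \<open>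
  The identity compares coefficients in an identity of generating functions.
  Let \<open>T\<close> be the generating function of the Tetranacci numbers and
  \<open>Q = 1 - X - X\<^sup>2 - X\<^sup>3 - X\<^sup>4\<close>, so that \<open>Q T = X\<close> is the Tetranacci recurrence.
  Differentiating this equation and multiplying by \<open>Q\<close> gives
  \<open>Q\<^sup>2 T' = Q - X Q' = 1 + X\<^sup>2 + 2 X\<^sup>3 + 3 X\<^sup>4\<close>, while \<open>Q\<^sup>2 T\<^sup>2 = X\<^sup>2\<close>. Hence
  \<open>T\<^sup>2 = X\<^sup>2 T' / (1 + X\<^sup>2 + 2 X\<^sup>3 + 3 X\<^sup>4)\<close>.
  On the left the coefficients are the convolutions of the Tetranacci numbers; on the right, those
  of \<open>T'\<close> are the factors \<open>(l + 1) T\<^bsub>l+1\<^esub>\<close>. It remains to see that \<open>D n l\<close> is the coefficient of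
  \<open>X^(n - 2 - l)\<close> in the reciprocal of \<open>1 + X\<^sup>2 + 2 X\<^sup>3 + 3 X\<^sup>4\<close>. This is the trinomial expansion of
  the geometric series in \<open>-(X\<^sup>2 + 2 X\<^sup>3 + 3 X\<^sup>4)\<close>: choosing \<open>X\<^sup>2\<close>, \<open>2 X\<^sup>3\<close> and \<open>3 X\<^sup>4\<close>
  respectively \<open>i\<close>, \<open>j\<close> and \<open>k\<close> times produces the exponent \<open>2 i + 3 j + 4 k\<close>. Solving
  \<open>m = 2 i + 3 j + 4 k\<close> for \<open>i\<close> yields the entry \<open>(m - 3 j - 4 k) / 2\<close> of the trinomial
  coefficient, and the parity factor in \<open>D\<close> discards the pairs \<open>(j, k)\<close> for which this is not an
  integer. Instead of summing the geometric series, the lemma \<open>recip_fps\<close> verifies the product with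
  \<open>1 + X\<^sup>2 + 2 X\<^sup>3 + 3 X\<^sup>4\<close> by Pascal's rule for trinomial coefficients.
\<close>

unbundle fps_syntax

section \<open>The reciprocal of \<open>1 + X\<^sup>2 + 2 X\<^sup>3 + 3 X\<^sup>4\<close>\<close>

text \<open>
  The contribution of all words with \<open>i\<close>, \<open>j\<close> and \<open>k\<close> letters of the three kinds, the letters
  having the weights \<open>-1\<close>, \<open>-2\<close> and \<open>-3\<close>.
\<close>

definition recip_term :: "nat \<Rightarrow> nat \<Rightarrow> nat \<Rightarrow> rat" where
  "recip_term i j k =
     (-1) ^ (i + j + k) * (fact (i + j + k) / (fact i * fact j * fact k)) * 2 ^ j * 3 ^ k"

definition exponent_triples :: "nat \<Rightarrow> (nat \<times> nat \<times> nat) set" where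
  "exponent_triples m = {(i, j, k). 2 * i + 3 * j + 4 * k = m}"

definition recip_coeff :: "nat \<Rightarrow> rat" where
  "recip_coeff m = (\<Sum>(i, j, k) \<in> exponent_triples m. recip_term i j k)"

lemma finite_exponent_triples: "finite (exponent_triples m)"
proof (rule finite_subset)
  show "exponent_triples m \<subseteq> {..m} \<times> {..m} \<times> {..m}"
    by (auto simp: exponent_triples_def)
qed simp

text \<open>
  Weighted form of Pascal's rule for trinomial coefficients: a word of positive length is sorted by
  its last letter, and removing that letter takes its weight away.
\<close>

lemma recip_term_pascal:
  assumes "i + j + k > 0"
  shows "recip_term i j k =
    - (if i = 0 then 0 else recip_term (i - 1) j k)
    - 2 * (if j = 0 then 0 else recip_term i (j - 1) k)
    - 3 * (if k = 0 then 0 else recip_term i j (k - 1))"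
proof -
  define r where "r = i + j + k - 1"
  have r: "i + j + k = Suc r" using assms by (simp add: r_def)
  \<comment> \<open>Removing one of the \<open>i\<close> letters of the first kind multiplies the trinomial coefficient by
    the fraction \<open>i / (i + j + k)\<close>, and likewise for \<open>j\<close> and \<open>k\<close>; the three fractions add up to 1.\<close>
  define w :: rat where "w = (-1) ^ r * fact r / (fact i * fact j * fact k) * 2 ^ j * 3 ^ k"
  have a: "(if i = 0 then 0 else recip_term (i - 1) j k) = of_nat i * w"
  proof (cases i)
    case (Suc i')
    then have "i' + j + k = r" using r by simp
    then show ?thesis using Suc by (simp add: recip_term_def w_def field_simps del: of_nat_Suc)
  qed simp
  have b: "2 * (if j = 0 then 0 else recip_term i (j - 1) k) = of_nat j * w"
  proof (cases j)
    case (Suc j')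
    then have "i + j' + k = r" using r by simp
    then show ?thesis using Suc by (simp add: recip_term_def w_def field_simps del: of_nat_Suc)
  qed simp
  have c: "3 * (if k = 0 then 0 else recip_term i j (k - 1)) = of_nat k * w"
  proof (cases k)
    case (Suc k')
    then have "i + j + k' = r" using r by simp
    then show ?thesis using Suc by (simp add: recip_term_def w_def field_simps del: of_nat_Suc)
  qed simp
  have "recip_term i j k = - of_nat (Suc r) * w"
    by (simp add: recip_term_def r w_def del: of_nat_Suc)
  also have "\<dots> = - of_nat i * w - of_nat j * w - of_nat k * w"
    by (simp add: r[symmetric] algebra_simps del: of_nat_Suc)
  finally show ?thesis unfolding a b c by simp
qed

lemma recip_coeff_recurrence:
  assumes "m > 0"
  shows "recip_coeff m =
    - (if m < 2 then 0 else recip_coeff (m - 2))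
    - 2 * (if m < 3 then 0 else recip_coeff (m - 3))
    - 3 * (if m < 4 then 0 else recip_coeff (m - 4))"
proof -
  let ?S = exponent_triples
  have a: "(\<Sum>(i, j, k) \<in> ?S m. if i = 0 then 0 else recip_term (i - 1) j k) =
    (if m < 2 then 0 else recip_coeff (m - 2))" (is "?l = _")
  proof -
    have "?l = (\<Sum>(i, j, k) \<in> {(i, j, k) \<in> ?S m. i > 0}. recip_term (i - 1) j k)"
      by (rule sum.mono_neutral_cong_right) (auto simp: finite_exponent_triples split: if_splits)
    also have "\<dots> = (\<Sum>(i, j, k) \<in> (if m < 2 then {} else ?S (m - 2)). recip_term i j k)"
      by (rule sum.reindex_bij_witness[where j = "\<lambda>(i, j, k). (i - 1, j, k)"
            and i = "\<lambda>(i, j, k). (i + 1, j, k)"]) (auto simp: exponent_triples_def split: if_splits)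
    finally show ?thesis by (simp add: recip_coeff_def)
  qed
  have b: "(\<Sum>(i, j, k) \<in> ?S m. if j = 0 then 0 else recip_term i (j - 1) k) =
    (if m < 3 then 0 else recip_coeff (m - 3))" (is "?l = _")
  proof -
    have "?l = (\<Sum>(i, j, k) \<in> {(i, j, k) \<in> ?S m. j > 0}. recip_term i (j - 1) k)"
      by (rule sum.mono_neutral_cong_right) (auto simp: finite_exponent_triples split: if_splits)
    also have "\<dots> = (\<Sum>(i, j, k) \<in> (if m < 3 then {} else ?S (m - 3)). recip_term i j k)"
      by (rule sum.reindex_bij_witness[where j = "\<lambda>(i, j, k). (i, j - 1, k)"
            and i = "\<lambda>(i, j, k). (i, j + 1, k)"]) (auto simp: exponent_triples_def split: if_splits)
    finally show ?thesis by (simp add: recip_coeff_def)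
  qed
  have c: "(\<Sum>(i, j, k) \<in> ?S m. if k = 0 then 0 else recip_term i j (k - 1)) =
    (if m < 4 then 0 else recip_coeff (m - 4))" (is "?l = _")
  proof -
    have "?l = (\<Sum>(i, j, k) \<in> {(i, j, k) \<in> ?S m. k > 0}. recip_term i j (k - 1))"
      by (rule sum.mono_neutral_cong_right) (auto simp: finite_exponent_triples split: if_splits)
    also have "\<dots> = (\<Sum>(i, j, k) \<in> (if m < 4 then {} else ?S (m - 4)). recip_term i j k)"
      by (rule sum.reindex_bij_witness[where j = "\<lambda>(i, j, k). (i, j, k - 1)"
            and i = "\<lambda>(i, j, k). (i, j, k + 1)"]) (auto simp: exponent_triples_def split: if_splits)
    finally show ?thesis by (simp add: recip_coeff_def)
  qed
  have "recip_coeff m = (\<Sum>(i, j, k) \<in> ?S m.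
      - (if i = 0 then 0 else recip_term (i - 1) j k)
      - 2 * (if j = 0 then 0 else recip_term i (j - 1) k)
      - 3 * (if k = 0 then 0 else recip_term i j (k - 1)))"
    unfolding recip_coeff_def
  proof (rule sum.cong[OF refl], clarify)
    fix i j k assume "(i, j, k) \<in> ?S m"
    then have "i + j + k > 0" using assms by (auto simp: exponent_triples_def)
    then show "recip_term i j k =
      - (if i = 0 then 0 else recip_term (i - 1) j k)
      - 2 * (if j = 0 then 0 else recip_term i (j - 1) k)
      - 3 * (if k = 0 then 0 else recip_term i j (k - 1))"
      by (rule recip_term_pascal)
  qed
  also have "\<dots> = - (if m < 2 then 0 else recip_coeff (m - 2))
    - 2 * (if m < 3 then 0 else recip_coeff (m - 3))
    - 3 * (if m < 4 then 0 else recip_coeff (m - 4))"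
    unfolding a[symmetric] b[symmetric] c[symmetric]
    by (simp only: case_prod_unfold sum_subtractf sum_negf sum_distrib_left)
  finally show ?thesis .
qed

lemma recip_coeff_0: "recip_coeff 0 = 1"
proof -
  have "exponent_triples 0 = {(0, 0, 0)}" by (auto simp: exponent_triples_def)
  then show ?thesis by (simp add: recip_coeff_def recip_term_def)
qed

lemma recip_fps:
  "(1 + fps_X ^ 2 + fps_const 2 * fps_X ^ 3 + fps_const 3 * fps_X ^ 4) * Abs_fps recip_coeff = 1"
proof (rule fps_ext)
  fix m
  have "((1 + fps_X ^ 2 + fps_const 2 * fps_X ^ 3 + fps_const 3 * fps_X ^ 4) * Abs_fps recip_coeff) $ m
    = recip_coeff m + (if m < 2 then 0 else recip_coeff (m - 2))
      + 2 * (if m < 3 then 0 else recip_coeff (m - 3))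
      + 3 * (if m < 4 then 0 else recip_coeff (m - 4))"
    by (simp only: distrib_right mult_1_left mult.assoc fps_add_nth fps_mult_left_const_nth
        fps_X_power_mult_nth fps_nth_Abs_fps)
  also have "\<dots> = 1 $ m"
  proof (cases "m = 0")
    case True
    then show ?thesis by (simp add: recip_coeff_0)
  next
    case False
    then show ?thesis using recip_coeff_recurrence[of m] by simp
  qed
  finally show "((1 + fps_X ^ 2 + fps_const 2 * fps_X ^ 3 + fps_const 3 * fps_X ^ 4)
      * Abs_fps recip_coeff) $ m = 1 $ m" .
qed

text \<open>
  The nonvanishing terms of \<open>D n l\<close> are those with \<open>m - 3 j - 4 k\<close> even and nonnegative, where
  \<open>m = n - 2 - l\<close>, and these pairs \<open>(j, k)\<close> are in bijection with the triples \<open>(i, j, k)\<close> such that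
  \<open>2 i + 3 j + 4 k = m\<close>.
\<close>

lemma D_eq_recip_coeff:
  assumes "l + 2 \<le> n"
  shows "D n l = recip_coeff (n - 2 - l)"
proof -
  define m where "m = n - 2 - l"
  have m: "int n - 2 - int l = int m" using assms by (simp add: m_def)
  define A where "A = {(j :: nat, k :: nat).
    3 * int j + 2 * int k \<le> int m \<and> int j + 4 * int k \<le> int m}"
  define B where "B = {(j :: nat, k :: nat). 3 * j + 4 * k \<le> m \<and> even (m - 3 * j - 4 * k)}"
  define f where "f = (\<lambda>(j :: nat, k :: nat).
        (-1) powi ((int m - int j - 2 * int k) div 2)
        * ((1 + (-1) powi (int m - int j - 2 * int k)) / 2)
        * trinomial ((int m - int j - 2 * int k) div 2)
            ((int m - 3 * int j - 4 * int k) div 2) (int j) (int k)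
        * 2 ^ j * 3 ^ k)"
  have "D n l = sum f A" unfolding D_def m Let_def A_def f_def ..
  also have "\<dots> = sum f B"
  proof (rule sum.mono_neutral_right)
    show "finite A"
      by (rule finite_subset[of _ "{..m} \<times> {..m}"]) (auto simp: A_def)
    show "B \<subseteq> A" by (auto simp: A_def B_def)
    show "\<forall>p \<in> A - B. f p = 0"
    proof
      fix p assume p: "p \<in> A - B"
      obtain j k where jk: "p = (j, k)" by (cases p)
      show "f p = 0"
      proof (cases "3 * j + 4 * k \<le> m")
        case True
        then have "odd (m - 3 * j - 4 * k)" using p jk by (auto simp: B_def)
        then have "odd (int (m - 3 * j - 4 * k))" by simp
        moreover have "int (m - 3 * j - 4 * k) = int m - 3 * int j - 4 * int k" using True by simp
        ultimately have "odd (int m - int j - 2 * int k)" by simp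
        then show ?thesis by (simp add: f_def jk power_int_minus_left)
      next
        case False
        then have "(int m - 3 * int j - 4 * int k) div 2 < 0" by simp
        then show ?thesis by (simp add: f_def jk trinomial_def)
      qed
    qed
  qed
  also have "\<dots> = recip_coeff m"
    unfolding recip_coeff_def
  proof (rule sum.reindex_bij_witness[where j = "\<lambda>(j, k). ((m - 3 * j - 4 * k) div 2, j, k)"
        and i = "\<lambda>(i, j, k). (j, k)"])
    fix p assume p: "p \<in> B"
    obtain j k where jk: "p = (j, k)" by (cases p)
    then have "3 * j + 4 * k \<le> m" "even (m - 3 * j - 4 * k)" using p by (auto simp: B_def)
    then obtain i where "m - 3 * j - 4 * k = 2 * i" "3 * j + 4 * k \<le> m" by (metis evenE)
    then have i: "m = 2 * i + 3 * j + 4 * k" by simp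
    have e: "int m - int j - 2 * int k = 2 * int (i + j + k)"
      "int m - 3 * int j - 4 * int k = 2 * int i" using i by simp_all
    have "f p = recip_term i j k"
      unfolding f_def jk prod.case e
      by (simp add: trinomial_def recip_term_def power_int_minus_left nat_add_distrib
          flip: of_nat_add)
    then show "(case (case p of (j, k) \<Rightarrow> ((m - 3 * j - 4 * k) div 2, j, k)) of
        (i, j, k) \<Rightarrow> recip_term i j k) = f p"
      using i jk by simp
  qed (auto simp: B_def exponent_triples_def)
  finally show ?thesis by (simp add: m_def)
qed

section \<open>The generating function of the Tetranacci numbers\<close>

abbreviation tetranacci_fps :: "rat fps" where
  "tetranacci_fps \<equiv> Abs_fps (\<lambda>n. of_nat (tetranacci n))"

abbreviation tetranacci_denominator :: "rat fps" where
  "tetranacci_denominator \<equiv> 1 - fps_X - fps_X ^ 2 - fps_X ^ 3 - fps_X ^ 4"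

lemma tetranacci_fps_denominator: "tetranacci_denominator * tetranacci_fps = fps_X"
proof (rule fps_ext)
  fix n
  let ?t = "\<lambda>n. rat_of_nat (tetranacci n)"
  have "(tetranacci_denominator * tetranacci_fps) $ n =
    ?t n - (if n = 0 then 0 else ?t (n - 1)) - (if n < 2 then 0 else ?t (n - 2))
      - (if n < 3 then 0 else ?t (n - 3)) - (if n < 4 then 0 else ?t (n - 4))"
    by (simp only: left_diff_distrib mult_1_left fps_sub_nth fps_X_mult_nth
        fps_X_power_mult_nth fps_nth_Abs_fps)
  also have "\<dots> = fps_X $ n"
  proof -
    consider "n = 0" | "n = 1" | "n = 2" | "n = 3" | k where "n = Suc (Suc (Suc (Suc k)))"
      by (metis One_nat_def Suc_1 numeral_3_eq_3 not0_implies_Suc)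
    then show ?thesis
      by cases (simp_all add: numeral_2_eq_2 numeral_3_eq_3 eval_nat_numeral fps_X_nth)
  qed
  finally show "(tetranacci_denominator * tetranacci_fps) $ n = fps_X $ n" .
qed

text \<open>
  Both sides agree after multiplication by the square of the denominator \<open>Q\<close>, where the equation
  \<open>Q T = X\<close> and its derivative eliminate \<open>T\<close> and \<open>T'\<close>.
\<close>

lemma tetranacci_fps_square:
  "tetranacci_fps ^ 2 = fps_X ^ 2 * (fps_deriv tetranacci_fps * Abs_fps recip_coeff)"
proof -
  define T where "T = tetranacci_fps"
  define Q where "Q = tetranacci_denominator"
  define E where "E = Abs_fps recip_coeff"
  define P where "P = 1 + fps_X ^ 2 + fps_const 2 * fps_X ^ 3 + fps_const (3::rat) * fps_X ^ 4"
  have QT: "Q * T = fps_X" unfolding Q_def T_def by (rule tetranacci_fps_denominator)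
  have PE: "P * E = 1" unfolding P_def E_def by (rule recip_fps)
  have "fps_deriv (Q * T) = 1" by (simp add: QT)
  then have deriv: "Q * fps_deriv T + fps_deriv Q * T = 1" by simp
  have Q': "fps_deriv Q =
      - 1 - fps_const 2 * fps_X - fps_const 3 * fps_X ^ 2 - fps_const 4 * fps_X ^ 3"
    by (simp add: Q_def fps_deriv_power eval_nat_numeral flip: numeral_fps_const)
  have "Q ^ 2 * fps_deriv T = Q * (1 - fps_deriv Q * T)"
    using deriv by (simp add: power2_eq_square algebra_simps flip: deriv)
  also have "\<dots> = Q - fps_deriv Q * (Q * T)" by (simp add: algebra_simps)
  also have "\<dots> = P"
    unfolding QT Q' unfolding Q_def P_def
    by (simp add: algebra_simps power2_eq_square power3_eq_cube power4_eq_xxxx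
        flip: numeral_fps_const)
  finally have QQ: "Q ^ 2 * fps_deriv T = P" .
  have "Q ^ 2 * T ^ 2 = fps_X ^ 2" by (simp add: QT flip: power_mult_distrib)
  also have "\<dots> = fps_X ^ 2 * (Q ^ 2 * fps_deriv T * E)" by (simp add: QQ PE)
  finally have "Q ^ 2 * T ^ 2 = Q ^ 2 * (fps_X ^ 2 * (fps_deriv T * E))"
    by (simp add: algebra_simps)
  moreover have "Q $ 0 = 1" by (simp add: Q_def)
  then have "Q ^ 2 \<noteq> 0" by auto
  ultimately show ?thesis unfolding T_def E_def by (simp del: power_eq_0_iff)
qed

section \<open>The convolution formula\<close>

theorem theorem2:
  fixes n :: nat
  assumes "n \<ge> 2"
  shows "rat_of_nat (\<Sum>k=0..n. tetranacci k * tetranacci (n - k)) =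
    (\<Sum>l=0..n - 2. rat_of_nat ((l + 1) * tetranacci (l + 1)) * D n l)"
proof -
  have "rat_of_nat (\<Sum>k=0..n. tetranacci k * tetranacci (n - k)) = (tetranacci_fps ^ 2) $ n"
    by (simp add: power2_eq_square fps_mult_nth)
  also have "\<dots> = (fps_deriv tetranacci_fps * Abs_fps recip_coeff) $ (n - 2)"
    using assms unfolding tetranacci_fps_square by (simp only: fps_X_power_mult_nth) simp
  also have "\<dots> =
      (\<Sum>l=0..n - 2. rat_of_nat ((l + 1) * tetranacci (l + 1)) * recip_coeff (n - 2 - l))"
    by (simp add: fps_mult_nth distrib_right)
  also have "\<dots> = (\<Sum>l=0..n - 2. rat_of_nat ((l + 1) * tetranacci (l + 1)) * D n l)"
    by (rule sum.cong) (use assms in \<open>auto simp: D_eq_recip_coeff\<close>)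
  finally show ?thesis .
qed

end
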